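(* Let $v^k$, $b^k$ and $d^k$ be the sequences produced by Algorithm 2 (described in the context) for the data $(g,a)$. Then $v^k\to v$ and $b^k\to\frac1{2\alpha}J$, where $v$ is a solution of the primal problem $$(P_N)\qquad \alpha_{P_N}=\min_{w\in\mathcal{M}_0}\tfrac12\sum_{i,j}a_{ij}\,|w_i-w_j+(v_g)_i-(v_g)_j|$$ and $J$ gives a solution $-\tfrac12J$ of its dual problem $$(D_N)\qquad \alpha_{D_N}=\sup_{b\in\mathcal{D}}\{-\langle b,Dv_g\rangle_{\mathcal{H}(E)}\}.$$ In addition $d^k\to Dv$. In particular, $y:=v+v_g$ is a voltage potential corresponding to the data $(\lambda g,a)$ for some $\lambda\in\mathbb{R}$, i.e. $y\in\mathcal{V}_{(\lambda g,a)}$, and $J$ is the induced current, with $|J|=a$, i.e. $|J_{ij}|=a_{ij}$ for all $i,j$. Moreover, $\lambda$ is the optimal value of the primal and dual problems $(P_N)$ and $(D_N)$, i.e. $\lambda=\alpha_{P_N}=\alpha_{D_N}$.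
   Context: $G=(V,E)$ is a simple, undirected, connected graph with $V=\{1,\dots,n\}$; $\partial V\subset V$ is a set of boundary vertices, $\mathrm{int}(V)=V\setminus\partial V$, and $g:\partial V\to\mathbb{R}$ satisfies $g\neq0$ and $\sum_{i\in\partial V}g_i=0$. A measurement matrix is a symmetric $n\times n$ matrix $a=(a_{ij})$ with $a_{ij}\in[0,\infty)$ and $a_{ij}=0$ if $i=j$ or $\{i,j\}\notin E$; $a$ is a fixed measurement matrix. $\mathcal{H}(V)=\mathbb{R}^n$ is the space of real functions on $V$; $\mathcal{M}_0=\{u\in\mathcal{H}(V):\sum_{i\in\partial V}u_ig_i=0\}$; $\mathcal{H}(E)$ is the space of real $n\times n$ matrices $b$ with $b_{ij}=0$ if $i=j$ or $\{i,j\}\notin E$, with $\langle b,d\rangle_{\mathcal{H}(E)}=\sum_{i,j}b_{ij}d_{ij}$. For $u\in\mathcal{H}(V)$, $(Du)_{ij}=u_i-u_j$ if $\{i,j\}\in E$ and $0$ otherwise. For $b\in\mathcal{H}(E)$, $(\mathrm{div}\,b)_i=\sum_j(b_{ji}-b_{ij})$. $\mathcal{D}$ is the set of $b\in\mathcal{H}(E)$ with $|b_{ij}|\le\frac12a_{ij}$ for all $i,j$, $(\mathrm{div}\,b)_i=0$ for all $i\in\mathrm{int}(V)$, and, for some $\mu\in\mathbb{R}$, $(\mathrm{div}\,b)_i=\mu g_i$ for all $i\in\partial V$. Algorithm 2: let $\alpha>0$, let $v_g\in\mathcal{H}(V)$ with $\sum_{i\in\partial V}(v_g)_ig_i=1$,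 and initialize $b^0,d^0\in\mathcal{H}(E)$. Let $z\in\mathbb{R}^n$ be the solution of $\sum_j(Dz)_{ij}=0$ for $i\in\mathrm{int}(V)$, $\sum_j(Dz)_{ij}=g_i$ for $i\in\partial V$, with $z_1=0$. For $k\ge0$: (1a) solve $\sum_j(Du^{k+1})_{ij}=\frac12[(\mathrm{div}\,b^k)_i-(\mathrm{div}\,d^k)_i]$ for all $i\in V$, with $u^{k+1}_1=0$; (1b) compute $\beta^{k+1}=-\dfrac{\sum_{i\in\partial V}u^{k+1}_ig_i}{\sum_{i\in\partial V}z_ig_i}$ and set $v^{k+1}=u^{k+1}+\beta^{k+1}z$; (2) with $w_{ij}=(Dv^{k+1})_{ij}+(Dv_g)_{ij}+b^k_{ij}$, set $d^{k+1}_{ij}=\max\{|w_{ij}|-\frac{a_{ij}}{2\alpha},0\}\frac{w_{ij}}{|w_{ij}|}-(Dv_g)_{ij}$ if $w_{ij}\neq0$ and $d^{k+1}_{ij}=-(Dv_g)_{ij}$ if $w_{ij}=0$; (3) set $b^{k+1}_{ij}=b^k_{ij}+(Dv^{k+1})_{ij}-d^{k+1}_{ij}$. A current is a real $n\times n$ matrix $K=(K_{ij})$ with $K_{ij}=-K_{ji}$, $K_{ii}=0$, and $K_{ij}=0$ whenever $\{i,j\}\notin E$. For $0\neq h:\partial V\to\mathbb{R}$ with $\sum_{i\in\partial V}h_i=0$, the set $\mathcal{V}_{(h,a)}$ of voltage potentials corresponding to $(h,a)$ consists of all $y\in\mathbb{R}^n$ for which there exist a symmetric matrix $\sigma=(\sigma_{ij})$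 with $\sigma_{ij}\in[0,\infty]$ and a current $K$ such that $K_{ij}=\sigma_{ij}(y_i-y_j)$ and $|K_{ij}|=a_{ij}$ for all $i,j$ with $y_i\neq y_j$, $\sum_jK_{ij}=h_i$ for all $i\in\partial V$, and $\sum_jK_{ij}=0$ for all $i\in\mathrm{int}(V)$; when $a_{ij}\neq0$ and $y_i=y_j$ one formally sets $\sigma_{ij}=\infty$ (perfect conductor). Such a $K$ is called an induced current corresponding to $y$.
   Formalization: |J_ij|=a_ij is claimed only where y_i≠y_j (it can fail on other edges); J itself is the induced current when b^0 is antisymmetric, and for general b^0 the antisymmetric part (J-J^T)/2 is (J need not be a current); λ=0 is allowed in V_(λg,a). *)

theory Defs
  imports "HOL-Analysis.Analysis"
begin

(* The vertex set is an arbitrary finite type 'n; functions on vertices are real^'n and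
   n x n matrices are real^'n^'n, whose inner product is the sum over i, j of b_ij d_ij.
   B is the set of boundary vertices.  Boundary data are functions g :: 'n => real of which
   only the values on B are ever used. *)

definition simple_graph :: "'n set set \<Rightarrow> bool" where
  "simple_graph E \<longleftrightarrow> (\<forall>e\<in>E. card e = 2)"

definition connected_graph :: "'n set set \<Rightarrow> bool" where
  "connected_graph E \<longleftrightarrow> (\<forall>i j. (i, j) \<in> {(i, j). {i, j} \<in> E}\<^sup>*)"

definition edge_space :: "'n set set \<Rightarrow> (real^'n^'n) set" where
  "edge_space E = {b. \<forall>i j. (i = j \<or> {i, j} \<notin> E) \<longrightarrow> b $ i $ j = 0}"

definition measurement_matrix :: "'n set set \<Rightarrow> real^'n^'n \<Rightarrow> bool" where
  "measurement_matrix E a \<longleftrightarrow>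
     a \<in> edge_space E \<and> (\<forall>i j. a $ i $ j = a $ j $ i \<and> 0 \<le> a $ i $ j)"

definition grad :: "'n set set \<Rightarrow> real^'n \<Rightarrow> real^'n^'n" where
  "grad E u = (\<chi> i j. if {i, j} \<in> E then u $ i - u $ j else 0)"

definition divergence :: "real^'n^'n \<Rightarrow> real^'n" where
  "divergence b = (\<chi> i. \<Sum>j\<in>UNIV. b $ j $ i - b $ i $ j)"

definition M0 :: "'n set \<Rightarrow> ('n \<Rightarrow> real) \<Rightarrow> (real^'n) set" where
  "M0 B g = {u. (\<Sum>i\<in>B. u $ i * g i) = 0}"

definition dual_feasible ::
    "'n set set \<Rightarrow> 'n set \<Rightarrow> ('n \<Rightarrow> real) \<Rightarrow> real^'n^'n \<Rightarrow> (real^'n^'n) set" where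
  "dual_feasible E B g a =
     {b \<in> edge_space E.
        (\<forall>i j. \<bar>b $ i $ j\<bar> \<le> a $ i $ j / 2) \<and>
        (\<forall>i. i \<notin> B \<longrightarrow> divergence b $ i = 0) \<and>
        (\<exists>\<mu>. \<forall>i\<in>B. divergence b $ i = \<mu> * g i)}"

definition primal_objective :: "real^'n^'n \<Rightarrow> real^'n \<Rightarrow> real^'n \<Rightarrow> real" where
  "primal_objective a vg w =
     1/2 * (\<Sum>i\<in>UNIV. \<Sum>j\<in>UNIV. a $ i $ j * \<bar>w $ i - w $ j + vg $ i - vg $ j\<bar>)"

definition dual_objective :: "'n set set \<Rightarrow> real^'n \<Rightarrow> real^'n^'n \<Rightarrow> real" where
  "dual_objective E vg b = - (b \<bullet> grad E vg)"

definition primal_value ::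
    "'n set \<Rightarrow> ('n \<Rightarrow> real) \<Rightarrow> real^'n^'n \<Rightarrow> real^'n \<Rightarrow> real" where
  "primal_value B g a vg = (INF w\<in>M0 B g. primal_objective a vg w)"

(* For a measurement matrix a, the dual feasible set contains 0 and is bounded, so this
   supremum is genuine; likewise the infimum above is over a nonempty set of nonnegative values. *)
definition dual_value ::
    "'n set set \<Rightarrow> 'n set \<Rightarrow> ('n \<Rightarrow> real) \<Rightarrow> real^'n^'n \<Rightarrow> real^'n \<Rightarrow> real" where
  "dual_value E B g a vg = (SUP b\<in>dual_feasible E B g a. dual_objective E vg b)"

(* r is the grounded vertex (vertex 1 when V = {1..n}).  The entries u 0, v 0 and \<beta> 0 are
   not constrained: these iterates start at index 1, whereas b 0 and d 0 are the initial data. *)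
definition algorithm2 ::
    "'n set set \<Rightarrow> 'n set \<Rightarrow> ('n \<Rightarrow> real) \<Rightarrow> real^'n^'n \<Rightarrow> real \<Rightarrow> real^'n \<Rightarrow> 'n \<Rightarrow>
     real^'n \<Rightarrow> (nat \<Rightarrow> real^'n) \<Rightarrow> (nat \<Rightarrow> real) \<Rightarrow>
     (nat \<Rightarrow> real^'n) \<Rightarrow> (nat \<Rightarrow> real^'n^'n) \<Rightarrow> (nat \<Rightarrow> real^'n^'n) \<Rightarrow> bool" where
  "algorithm2 E B g a \<alpha> vg r z u \<beta> v b d \<longleftrightarrow>
     b 0 \<in> edge_space E \<and> d 0 \<in> edge_space E \<and>
     (\<forall>i. (\<Sum>j\<in>UNIV. grad E z $ i $ j) = (if i \<in> B then g i else 0)) \<and> z $ r = 0 \<and>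
     (\<forall>k.
        (\<forall>i. (\<Sum>j\<in>UNIV. grad E (u (Suc k)) $ i $ j) =
               1/2 * (divergence (b k) $ i - divergence (d k) $ i)) \<and>
        u (Suc k) $ r = 0 \<and>
        \<beta> (Suc k) = - (\<Sum>i\<in>B. u (Suc k) $ i * g i) / (\<Sum>i\<in>B. z $ i * g i) \<and>
        v (Suc k) = u (Suc k) + \<beta> (Suc k) *\<^sub>R z \<and>
        (\<forall>i j.
           let w = grad E (v (Suc k)) $ i $ j + grad E vg $ i $ j + b k $ i $ j in
           d (Suc k) $ i $ j =
             (if w \<noteq> 0
              then max (\<bar>w\<bar> - a $ i $ j / (2 * \<alpha>)) 0 * (w / \<bar>w\<bar>) - grad E vg $ i $ j
              else - grad E vg $ i $ j)) \<and>
        b (Suc k) = b k + grad E (v (Suc k)) - d (Suc k))"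

definition current :: "'n set set \<Rightarrow> real^'n^'n \<Rightarrow> bool" where
  "current E K \<longleftrightarrow> K \<in> edge_space E \<and> (\<forall>i j. K $ i $ j = - K $ j $ i)"

(* Where y_i = y_j, neither Ohm's law nor |K_ij| = a_ij is required; only the convention that
   the edge is a perfect conductor if a_ij is nonzero.  The predicate is total in h, and in
   particular h = 0 is not excluded. *)
definition induced_current ::
    "'n set set \<Rightarrow> 'n set \<Rightarrow> ('n \<Rightarrow> real) \<Rightarrow> real^'n^'n \<Rightarrow> real^'n \<Rightarrow> real^'n^'n \<Rightarrow> bool" where
  "induced_current E B h a y K \<longleftrightarrow>
     current E K \<and>
     (\<exists>\<sigma> :: 'n \<Rightarrow> 'n \<Rightarrow> ereal.
        (\<forall>i j. \<sigma> i j = \<sigma> j i \<and> 0 \<le> \<sigma> i j) \<and>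
        (\<forall>i j. y $ i \<noteq> y $ j \<longrightarrow> ereal (K $ i $ j) = \<sigma> i j * ereal (y $ i - y $ j)) \<and>
        (\<forall>i j. a $ i $ j \<noteq> 0 \<and> y $ i = y $ j \<longrightarrow> \<sigma> i j = \<infinity>)) \<and>
     (\<forall>i j. y $ i \<noteq> y $ j \<longrightarrow> \<bar>K $ i $ j\<bar> = a $ i $ j) \<and>
     (\<forall>i\<in>B. (\<Sum>j\<in>UNIV. K $ i $ j) = h i) \<and>
     (\<forall>i. i \<notin> B \<longrightarrow> (\<Sum>j\<in>UNIV. K $ i $ j) = 0)"

definition voltage_potentials ::
    "'n set set \<Rightarrow> 'n set \<Rightarrow> ('n \<Rightarrow> real) \<Rightarrow> real^'n^'n \<Rightarrow> (real^'n) set" where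
  "voltage_potentials E B h a = {y. \<exists>K. induced_current E B h a y K}"

end

theory Submission
  imports Defs
begin

text \<open>
  Write \<open>X\<close> for the subspace of gradients of potentials in \<open>M0 B g\<close>. The primal problem
  minimises a weighted l1 norm over the affine space \<open>grad E v\<^sub>g + X\<close>, and the algorithm is the
  alternating direction method of multipliers for it. The updates of \<open>u\<close>, \<open>\<beta>\<close> and \<open>v\<close> together make
  \<open>grad E (v (Suc k))\<close> the orthogonal projection of \<open>d k - b k\<close> onto \<open>X\<close>; the update of \<open>d\<close> is the proximal
  map of the weighted l1 norm (soft thresholding), shifted by \<open>grad E v\<^sub>g\<close> and applied to
  \<open>b k + grad E (v (Suc k))\<close>; the update of \<open>b\<close> keeps \<open>b (Suc k) + d (Suc k)\<close> equal to that argument. From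
  index 1 on the single variable \<open>q = b + d\<close> therefore carries the whole iteration: \<open>d\<close> is the
  thresholding \<open>S q\<close>, \<open>b\<close> is \<open>q - S q\<close>, and \<open>q\<close> is updated to \<open>q - S q\<close> plus the projection of
  \<open>2 S q - q\<close> onto \<open>X\<close>. This is Douglas--Rachford splitting.

  Such an update is firmly nonexpansive because \<open>S\<close> is a proximal map. So \<open>q\<close> is Fejer monotone with
  respect to the fixed points, and in finite dimension it converges to one of them as soon as there
  is one (\<open>douglas_rachford_converges\<close>). A fixed point amounts to a point \<open>x\<close> of \<open>X\<close> together
  with a subgradient of the l1 norm at \<open>x + grad E v\<^sub>g\<close> that is orthogonal to \<open>X\<close>. The point is
  a primal minimiser, which exists because the weights map the affine space to a closed set
  (\<open>weighted_l1_minimizer_exists\<close>); the subgradient comes from separating the compact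
  convex set of all subgradients from the orthogonal complement of \<open>X\<close>
  (\<open>minimizer_has_orthogonal_subgradient\<close>). Convergence of \<open>grad E (v k)\<close> gives convergence of
  \<open>v k\<close>, since the graph is connected and the iterates vanish at the grounded vertex.

  The limit satisfies the optimality conditions, and everything else is read off from them
  (\<open>saddle_point_optimality\<close>). Put \<open>J = 2 \<alpha> lim b\<close> and \<open>y = v' + v\<^sub>g\<close>. Orthogonality to \<open>X\<close> says
  that \<open>J\<close> has divergence \<open>- 2 l\<close> times \<open>g\<close>, extended by zero, with \<open>l\<close> half the inner product of
  \<open>J\<close> and \<open>grad E v\<^sub>g\<close>. The subgradient condition says that \<open>J\<close> is
  bounded by \<open>a\<close> and that \<open>J * (y i - y j) = a * \<bar>y i - y j\<bar>\<close> entrywise. Hence the primal value at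
  \<open>v'\<close> and the dual value at \<open>- J / 2\<close> are both \<open>l\<close>, and weak duality makes both optimal. The same
  two conditions are Ohm's law with conductivity \<open>a / \<bar>y i - y j\<bar>\<close> and Kirchhoff's law for the
  antisymmetric part of \<open>J\<close>, which is \<open>J\<close> itself if \<open>b 0\<close> is antisymmetric, as the
  iteration preserves antisymmetry.
\<close>

section \<open>Fejer monotone sequences and Douglas--Rachford splitting\<close>

text \<open>
  The distance to each point of \<open>F\<close> decreases, so it converges; the summand \<open>q (Suc n) - q n\<close>
  in the estimate then forces the steps to tend to zero. The sequence is bounded, so some
  cluster point exists. It lies in \<open>F\<close>, the distance to it tends to zero along a subsequence, and by monotonicity along the
  whole sequence.
\<close>

lemma fejer_monotone_converges:
  fixes q :: "nat \<Rightarrow> 'a::euclidean_space"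
  assumes "F \<noteq> {}"
    and fejer: "\<And>p n. p \<in> F \<Longrightarrow>
      (norm (q (Suc n) - p))\<^sup>2 + (norm (q (Suc n) - q n))\<^sup>2 \<le> (norm (q n - p))\<^sup>2"
    and cluster: "\<And>s x. strict_mono s \<Longrightarrow> (\<lambda>n. q (s n)) \<longlonglongrightarrow> x \<Longrightarrow>
      (\<lambda>n. q (Suc n) - q n) \<longlonglongrightarrow> 0 \<Longrightarrow> x \<in> F"
  obtains x where "x \<in> F" and "q \<longlonglongrightarrow> x"
proof -
  have dec: "norm (q (Suc n) - p) \<le> norm (q n - p)" if "p \<in> F" for p n
  proof (rule power2_le_imp_le)
    show "(norm (q (Suc n) - p))\<^sup>2 \<le> (norm (q n - p))\<^sup>2"
      using fejer[OF that, of n] zero_le_power2[of "norm (q (Suc n) - q n)"] by linarith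
  qed simp
  then have decs: "decseq (\<lambda>n. norm (q n - p))" if "p \<in> F" for p
    using that by (intro decseq_SucI) auto
  obtain p where p: "p \<in> F" using \<open>F \<noteq> {}\<close> by blast
  have steps: "(\<lambda>n. q (Suc n) - q n) \<longlonglongrightarrow> 0"
  proof -
    obtain l where l: "(\<lambda>n. norm (q n - p)) \<longlonglongrightarrow> l"
      using decseq_convergent[OF decs[OF p], of 0] by auto
    have "(\<lambda>n. (norm (q n - p))\<^sup>2 - (norm (q (Suc n) - p))\<^sup>2) \<longlonglongrightarrow> l\<^sup>2 - l\<^sup>2"
      by (intro tendsto_intros l LIMSEQ_Suc[OF l])
    then have lim: "(\<lambda>n. (norm (q n - p))\<^sup>2 - (norm (q (Suc n) - p))\<^sup>2) \<longlonglongrightarrow> 0"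
      by simp
    have "(norm (q (Suc n) - q n))\<^sup>2 \<le> (norm (q n - p))\<^sup>2 - (norm (q (Suc n) - p))\<^sup>2" for n
      using fejer[OF p, of n] by linarith
    then have "(\<lambda>n. (norm (q (Suc n) - q n))\<^sup>2) \<longlonglongrightarrow> 0"
      by (intro tendsto_sandwich[OF _ _ tendsto_const lim] always_eventually) auto
    then have "(\<lambda>n. sqrt ((norm (q (Suc n) - q n))\<^sup>2)) \<longlonglongrightarrow> sqrt 0"
      by (intro tendsto_intros)
    then show ?thesis
      by (simp add: tendsto_norm_zero_iff)
  qed
  have "norm (q n) \<le> norm (q 0 - p) + norm p" for n
    using decseqD[OF decs[OF p], of 0 n] norm_triangle_sub[of "q n" p] by simp
  then have "bounded (range q)"
    by (auto simp: bounded_iff)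
  then obtain x s where s: "strict_mono s" "(q \<circ> s) \<longlonglongrightarrow> x"
    using bounded_imp_convergent_subsequence by blast
  then have x: "x \<in> F"
    using cluster steps by (simp add: o_def)
  obtain l where l: "(\<lambda>n. norm (q n - x)) \<longlonglongrightarrow> l"
    using decseq_convergent[OF decs[OF x], of 0] by auto
  have "(\<lambda>n. norm (q (s n) - x)) \<longlonglongrightarrow> norm (x - x)"
    using s(2) by (intro tendsto_intros) (simp add: o_def)
  moreover have "(\<lambda>n. norm (q (s n) - x)) \<longlonglongrightarrow> l"
    using LIMSEQ_subseq_LIMSEQ[OF l s(1)] by (simp add: o_def)
  ultimately have "l = 0"
    using LIMSEQ_unique by fastforce
  then have "q \<longlonglongrightarrow> x"
    using l by (simp add: tendsto_norm_zero_iff LIM_zero_iff)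
  with x that show thesis by blast
qed

text \<open>
  The update \<open>q - s + p\<close> is firmly nonexpansive. The operator is stated through its values:
  \<open>s\<close> plays the role of \<open>S q\<close> and \<open>p\<close> is the orthogonal projection of \<open>2 s - q\<close> onto \<open>X\<close>. After
  taking differences, the slack in the inequality is twice the monotonicity expression plus twice an
  inner product that vanishes by orthogonality.
\<close>

lemma douglas_rachford_step:
  fixes q q' s s' p p' :: "'a::real_inner"
  assumes "subspace X"
    and mono: "(s - s') \<bullet> ((q - s) - (q' - s')) \<ge> 0"
    and "p \<in> X" "p' \<in> X"
    and "\<And>w. w \<in> X \<Longrightarrow> w \<bullet> (2 *\<^sub>R s - q - p) = 0"
    and "\<And>w. w \<in> X \<Longrightarrow> w \<bullet> (2 *\<^sub>R s' - q' - p') = 0"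
  shows "(norm ((q - s + p) - (q' - s' + p')))\<^sup>2 +
         (norm (((q - s + p) - q) - ((q' - s' + p') - q')))\<^sup>2 \<le> (norm (q - q'))\<^sup>2"
proof -
  define S Q P where "S = s - s'" and "Q = q - q'" and "P = p - p'"
  have "P \<in> X" using assms by (simp add: P_def subspace_diff)
  have orth: "P \<bullet> (2 *\<^sub>R S - Q - P) = 0"
    using assms(5)[OF \<open>P \<in> X\<close>] assms(6)[OF \<open>P \<in> X\<close>]
    by (simp add: S_def Q_def P_def inner_diff_right algebra_simps)
  have "S \<bullet> (Q - S) \<ge> 0"
    using mono by (simp add: S_def Q_def algebra_simps)
  moreover have "(norm Q)\<^sup>2 - (norm (Q - S + P))\<^sup>2 - (norm (P - S))\<^sup>2
      = 2 * (S \<bullet> (Q - S)) + 2 * (P \<bullet> (2 *\<^sub>R S - Q - P))"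
    by (simp add: power2_norm_eq_inner inner_commute algebra_simps)
  moreover have eqs: "(q - s + p) - (q' - s' + p') = Q - S + P"
    "((q - s + p) - q) - ((q' - s' + p') - q') = P - S" "q - q' = Q"
    by (simp_all add: S_def Q_def P_def)
  ultimately show ?thesis
    unfolding eqs using orth by linarith
qed

text \<open>
  The last two assumptions say that the projection of \<open>2 S x0 - x0\<close> onto \<open>X\<close> is \<open>S x0\<close>, which
  means that \<open>x0\<close> is a fixed point of the update. The monotonicity assumption makes \<open>S\<close> nonexpansive, hence
  continuous, so that these conditions hold at a cluster point.
\<close>

lemma douglas_rachford_converges:
  fixes S :: "'a::euclidean_space \<Rightarrow> 'a" and q p :: "nat \<Rightarrow> 'a"
  assumes X: "subspace X"
    and mono: "\<And>x y. (S x - S y) \<bullet> ((x - S x) - (y - S y)) \<ge> 0"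
    and step: "\<And>n. q (Suc n) = q n - S (q n) + p n"
    and p: "\<And>n. p n \<in> X"
    and orth: "\<And>n w. w \<in> X \<Longrightarrow> w \<bullet> (2 *\<^sub>R S (q n) - q n - p n) = 0"
    and fixed: "S x0 \<in> X" "\<And>w. w \<in> X \<Longrightarrow> w \<bullet> (x0 - S x0) = 0"
  shows "\<exists>x. q \<longlonglongrightarrow> x \<and> (\<lambda>n. S (q n)) \<longlonglongrightarrow> S x \<and> p \<longlonglongrightarrow> S x \<and>
    S x \<in> X \<and> (\<forall>w\<in>X. w \<bullet> (x - S x) = 0)"
proof -
  define F where "F = {x. S x \<in> X \<and> (\<forall>w\<in>X. w \<bullet> (x - S x) = 0)}"
  have lip: "norm (S x - S y) \<le> norm (x - y)" for x y
  proof -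
    have "(norm (S x - S y))\<^sup>2 \<le> (S x - S y) \<bullet> (x - y)"
      using mono[of x y] by (simp add: power2_norm_eq_inner algebra_simps inner_commute)
    also have "\<dots> \<le> norm (S x - S y) * norm (x - y)"
      by (rule norm_cauchy_schwarz)
    finally show ?thesis
      by (cases "norm (S x - S y) = 0") (auto simp: power2_eq_square)
  qed
  have S_lim: "(\<lambda>n. S (f n)) \<longlonglongrightarrow> S x" if "f \<longlonglongrightarrow> x" for f :: "nat \<Rightarrow> 'a" and x
  proof -
    have "(\<lambda>n. norm (f n - x)) \<longlonglongrightarrow> 0"
      using that by (simp add: tendsto_norm_zero_iff LIM_zero_iff)
    then have "(\<lambda>n. norm (S (f n) - S x)) \<longlonglongrightarrow> 0"
      by (rule tendsto_sandwich[OF _ _ tendsto_const, rotated 2]) (auto simp: lip)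
    then show ?thesis
      by (simp add: tendsto_norm_zero_iff LIM_zero_iff)
  qed
  have F: "F \<noteq> {}" using fixed by (auto simp: F_def)
  have fejer: "(norm (q (Suc n) - y))\<^sup>2 + (norm (q (Suc n) - q n))\<^sup>2 \<le> (norm (q n - y))\<^sup>2"
    if "y \<in> F" for y n
  proof -
    have "S y \<in> X" using \<open>y \<in> F\<close> by (simp add: F_def)
    moreover have "w \<bullet> (2 *\<^sub>R S y - y - S y) = 0" if "w \<in> X" for w
      using \<open>y \<in> F\<close> that by (simp add: F_def inner_diff_right)
    ultimately have "(norm ((q n - S (q n) + p n) - (y - S y + S y)))\<^sup>2 +
       (norm (((q n - S (q n) + p n) - q n) - ((y - S y + S y) - y)))\<^sup>2 \<le> (norm (q n - y))\<^sup>2"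
      by (intro douglas_rachford_step[OF X mono p] orth)
    then show ?thesis
      by (simp add: step)
  qed
  have cluster: "x \<in> F" if s: "strict_mono s" and lim: "(\<lambda>n. q (s n)) \<longlonglongrightarrow> x"
    and steps: "(\<lambda>n. q (Suc n) - q n) \<longlonglongrightarrow> 0" for s :: "nat \<Rightarrow> nat" and x
  proof -
    have "(\<lambda>n. q (Suc (s n)) - q (s n)) \<longlonglongrightarrow> 0"
      using LIMSEQ_subseq_LIMSEQ[OF steps s] by (simp add: o_def)
    then have "(\<lambda>n. (q (Suc (s n)) - q (s n)) + S (q (s n))) \<longlonglongrightarrow> 0 + S x"
      by (intro tendsto_add S_lim lim)
    then have p_lim: "(\<lambda>n. p (s n)) \<longlonglongrightarrow> S x"
      by (simp add: step)
    have "S x \<in> X"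
      by (rule closed_sequentially[OF closed_subspace[OF X] _ p_lim]) (rule p)
    moreover have "w \<bullet> (x - S x) = 0" if "w \<in> X" for w
    proof -
      have "(\<lambda>n. w \<bullet> (2 *\<^sub>R S (q (s n)) - q (s n) - p (s n))) \<longlonglongrightarrow> w \<bullet> (2 *\<^sub>R S x - x - S x)"
        by (intro tendsto_intros lim p_lim S_lim)
      then have "w \<bullet> (2 *\<^sub>R S x - x - S x) = 0"
        by (simp add: orth[OF that] LIMSEQ_const_iff)
      then show ?thesis
        by (simp add: inner_diff_right)
    qed
    ultimately show ?thesis by (simp add: F_def)
  qed
  obtain x where x: "x \<in> F" "q \<longlonglongrightarrow> x"
    by (rule fejer_monotone_converges[of F q]) (rule F, erule fejer, erule (2) cluster, blast)
  have "(\<lambda>n. q (Suc n) - q n + S (q n)) \<longlonglongrightarrow> x - x + S x"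
    by (intro tendsto_add tendsto_diff S_lim x LIMSEQ_Suc[OF x(2)])
  then have "p \<longlonglongrightarrow> S x" by (simp add: step)
  with x(1) show ?thesis
    by (intro exI[of _ x]) (simp add: F_def x(2) S_lim)
qed

section \<open>The weighted l1 norm\<close>

definition weighted_l1 :: "real^'n^'m \<Rightarrow> real^'n^'m \<Rightarrow> real" where
  "weighted_l1 t x = (\<Sum>i\<in>UNIV. \<Sum>j\<in>UNIV. t $ i $ j * \<bar>x $ i $ j\<bar>)"

text \<open>
  The subdifferential of the weighted l1 norm with nonnegative weights \<open>t\<close>. The product form of the
  second condition merges the cases \<open>c = \<plusminus>t\<close> for \<open>x\<close> of either sign, and it makes closedness
  and convexity in \<open>c\<close> evident.
\<close>

definition weighted_l1_subgradient :: "real^'n^'m \<Rightarrow> real^'n^'m \<Rightarrow> real^'n^'m \<Rightarrow> bool" where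
  "weighted_l1_subgradient t x c \<longleftrightarrow>
     (\<forall>i j. \<bar>c $ i $ j\<bar> \<le> t $ i $ j \<and> c $ i $ j * x $ i $ j = t $ i $ j * \<bar>x $ i $ j\<bar>)"

lemma inner_matrix: "x \<bullet> y = (\<Sum>i\<in>UNIV. \<Sum>j\<in>UNIV. x $ i $ j * y $ i $ j)"
  for x y :: "real^'n^'m"
  by (simp add: inner_vec_def)

lemma inner_le_weighted_l1:
  assumes "\<And>i j. \<bar>c $ i $ j\<bar> \<le> t $ i $ j"
  shows "c \<bullet> x \<le> weighted_l1 t x"
  unfolding inner_matrix weighted_l1_def
proof (intro sum_mono)
  fix i j
  have "c $ i $ j * x $ i $ j \<le> \<bar>c $ i $ j\<bar> * \<bar>x $ i $ j\<bar>"
    by (metis abs_ge_self abs_mult)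
  also have "\<dots> \<le> t $ i $ j * \<bar>x $ i $ j\<bar>"
    by (intro mult_right_mono assms) simp
  finally show "c $ i $ j * x $ i $ j \<le> t $ i $ j * \<bar>x $ i $ j\<bar>" .
qed

lemma inner_subgradient:
  "weighted_l1_subgradient t x c \<Longrightarrow> c \<bullet> x = weighted_l1 t x"
  by (simp add: weighted_l1_subgradient_def inner_matrix weighted_l1_def)

lemma weighted_l1_subgradient_monotone:
  assumes "weighted_l1_subgradient t x c" and "weighted_l1_subgradient t x' c'"
  shows "(x - x') \<bullet> (c - c') \<ge> 0"
proof -
  have "c \<bullet> x' \<le> c' \<bullet> x'" "c' \<bullet> x \<le> c \<bullet> x"
    using assms inner_le_weighted_l1[of c t x'] inner_le_weighted_l1[of c' t x]
    by (simp_all add: inner_subgradient) (simp_all add: weighted_l1_subgradient_def)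
  then show ?thesis
    by (simp add: inner_commute algebra_simps)
qed

lemma weighted_l1_subgradient_scaleR:
  assumes "0 \<le> s" and c: "weighted_l1_subgradient t x c"
  shows "weighted_l1_subgradient (s *\<^sub>R t) x (s *\<^sub>R c)"
  using assms by (auto simp: weighted_l1_subgradient_def abs_mult mult.assoc intro: mult_left_mono)

lemma norm_le_l1_matrix:
  "norm x \<le> (\<Sum>i\<in>UNIV. \<Sum>j\<in>UNIV. \<bar>x $ i $ j\<bar>)" for x :: "real^'n^'m"
proof -
  have "norm x \<le> (\<Sum>i\<in>UNIV. norm (x $ i))"
    unfolding norm_vec_def by (rule L2_set_le_sum) simp
  also have "\<dots> \<le> (\<Sum>i\<in>UNIV. \<Sum>j\<in>UNIV. \<bar>x $ i $ j\<bar>)"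
    by (intro sum_mono norm_le_l1_cart)
  finally show ?thesis .
qed

text \<open>
  Weights may vanish, so the objective need not be coercive on \<open>X\<close>. It is the unweighted l1 norm of
  the entrywise product with \<open>t\<close>, however, and this product maps the affine space \<open>X + e\<close> onto an affine
  space, which is closed. There the unweighted norm is coercive.
\<close>

lemma weighted_l1_minimizer_exists:
  fixes t e :: "real^'n^'m"
  assumes X: "subspace X" and t: "\<And>i j. 0 \<le> t $ i $ j"
  shows "\<exists>x\<in>X. \<forall>w\<in>X. weighted_l1 t (x + e) \<le> weighted_l1 t (w + e)"
proof -
  define T :: "real^'n^'m \<Rightarrow> real^'n^'m" where "T x = (\<chi> i j. t $ i $ j * x $ i $ j)" for x
  define N :: "real^'n^'m \<Rightarrow> real" where "N x = (\<Sum>i\<in>UNIV. \<Sum>j\<in>UNIV. \<bar>x $ i $ j\<bar>)" for x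
  have lin: "linear T"
    by (rule linearI) (simp_all add: T_def vec_eq_iff algebra_simps)
  have NT: "N (T x) = weighted_l1 t x" for x
    by (simp add: N_def T_def weighted_l1_def abs_mult t)
  define Y where "Y = (+) (T e) ` T ` X"
  have "closed Y"
    unfolding Y_def by (intro closed_translation closed_subspace linear_subspace_image lin X)
  have Y_iff: "y \<in> Y \<longleftrightarrow> (\<exists>w\<in>X. y = T (w + e))" for y
    by (auto simp: Y_def linear_add[OF lin] add.commute)
  have e: "T e \<in> Y"
    using subspace_0[OF X] unfolding Y_iff by (metis add_0)
  define C where "C = Y \<inter> cball 0 (N (T e))"
  have "norm (T e) \<le> N (T e)"
    unfolding N_def by (rule norm_le_l1_matrix)
  with e have "T e \<in> C" by (simp add: C_def)
  moreover have "compact C"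
    unfolding C_def using \<open>closed Y\<close> by (intro closed_Int_compact) auto
  moreover have "continuous_on C N"
    unfolding N_def by (intro continuous_intros)
  ultimately obtain y where y: "y \<in> C" "\<And>y'. y' \<in> C \<Longrightarrow> N y \<le> N y'"
    using continuous_attains_inf[of C N] by blast
  have min: "N y \<le> N y'" if "y' \<in> Y" for y'
  proof (cases "N y' \<le> N (T e)")
    case True
    have "norm y' \<le> N y'"
      unfolding N_def by (rule norm_le_l1_matrix)
    with True that have "y' \<in> C" by (simp add: C_def)
    then show ?thesis by (rule y)
  next
    case False
    with y(2)[OF \<open>T e \<in> C\<close>] show ?thesis by simp
  qed
  obtain x where "x \<in> X" "y = T (x + e)"
    using y(1) by (auto simp: C_def Y_iff)
  moreover have "T (w + e) \<in> Y" if "w \<in> X" for w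
    using that by (auto simp: Y_iff)
  ultimately show ?thesis
    using min by (intro bexI[of _ x] ballI) (simp_all flip: NT)
qed

lemma compact_convex_subgradients:
  fixes t x :: "real^'n^'m"
  shows "compact {c. weighted_l1_subgradient t x c}" "convex {c. weighted_l1_subgradient t x c}"
proof -
  have "norm c \<le> (\<Sum>i\<in>UNIV. \<Sum>j\<in>UNIV. t $ i $ j)" if "weighted_l1_subgradient t x c" for c
  proof -
    have "(\<Sum>i\<in>UNIV. \<Sum>j\<in>UNIV. \<bar>c $ i $ j\<bar>) \<le> (\<Sum>i\<in>UNIV. \<Sum>j\<in>UNIV. t $ i $ j)"
      using that by (intro sum_mono) (simp add: weighted_l1_subgradient_def)
    with norm_le_l1_matrix[of c] show ?thesis by linarith
  qed
  then have "bounded {c. weighted_l1_subgradient t x c}"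
    by (auto simp: bounded_iff)
  moreover have "closed {c. weighted_l1_subgradient t x c}"
    unfolding weighted_l1_subgradient_def
    by (intro closed_Collect_all closed_Collect_conj closed_Collect_le closed_Collect_eq
        continuous_intros)
  ultimately show "compact {c. weighted_l1_subgradient t x c}"
    by (simp add: compact_eq_bounded_closed)
  show "convex {c. weighted_l1_subgradient t x c}"
  proof (rule convexI)
    fix c c' :: "real^'n^'m" and u v :: real
    assume c: "c \<in> {c. weighted_l1_subgradient t x c}" "c' \<in> {c. weighted_l1_subgradient t x c}"
      and uv: "0 \<le> u" "0 \<le> v" "u + v = 1"
    have "\<bar>u * c $ i $ j + v * c' $ i $ j\<bar> \<le> t $ i $ j" for i j
      using c convexD[OF convex_real_interval(5)[of "- t $ i $ j" "t $ i $ j"], of "c $ i $ j" "c' $ i $ j" u v] uv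
      by (auto simp: weighted_l1_subgradient_def abs_le_iff minus_le_iff)
    moreover have "(u * c $ i $ j + v * c' $ i $ j) * x $ i $ j
        = (u + v) * (t $ i $ j * \<bar>x $ i $ j\<bar>)" for i j
      using c by (simp add: weighted_l1_subgradient_def distrib_right mult.assoc)
    ultimately show "u *\<^sub>R c + v *\<^sub>R c' \<in> {c. weighted_l1_subgradient t x c}"
      using uv by (simp add: weighted_l1_subgradient_def)
  qed
qed

text \<open>
  The one-sided derivative in direction \<open>h\<close> is the inner product with a subgradient, and since the
  norm is piecewise linear the first-order expansion is exact for a small step.
\<close>

lemma weighted_l1_directional_derivative:
  fixes t x h :: "real^'n^'m"
  assumes t: "\<And>i j. 0 \<le> t $ i $ j"
  obtains c \<epsilon> where "weighted_l1_subgradient t x c" "\<epsilon> > 0"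
    "weighted_l1 t (x + \<epsilon> *\<^sub>R h) = weighted_l1 t x + \<epsilon> * (h \<bullet> c)"
proof -
  \<comment> \<open>On the entries where \<open>x\<close> vanishes, the subgradient that is extremal in direction \<open>h\<close>.\<close>
  define c :: "real^'n^'m" where
    "c = (\<chi> i j. t $ i $ j * (if x $ i $ j = 0 then sgn (h $ i $ j) else sgn (x $ i $ j)))"
  have "\<bar>c $ i $ j\<bar> \<le> t $ i $ j" for i j
    using t[of i j] by (auto simp: c_def sgn_if)
  moreover have "c $ i $ j * x $ i $ j = t $ i $ j * \<bar>x $ i $ j\<bar>" for i j
    by (auto simp: c_def sgn_if)
  ultimately have c: "weighted_l1_subgradient t x c"
    by (simp add: weighted_l1_subgradient_def)
  have "\<forall>\<^sub>F s in at_right 0. t $ i $ j * \<bar>x $ i $ j + s * h $ i $ j\<bar>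
      = t $ i $ j * \<bar>x $ i $ j\<bar> + s * (h $ i $ j * c $ i $ j)" for i j
  proof (cases "x $ i $ j = 0")
    case True
    have "\<forall>\<^sub>F s in at_right 0. (0::real) < s"
      by (rule eventually_at_right_less)
    then show ?thesis
      by eventually_elim (simp add: True c_def abs_mult sgn_if)
  next
    case False
    have "((\<lambda>s. x $ i $ j + s * h $ i $ j) \<longlongrightarrow> x $ i $ j + 0 * h $ i $ j) (at_right 0)"
      by (intro tendsto_intros)
    then have "((\<lambda>s. sgn (x $ i $ j) * (x $ i $ j + s * h $ i $ j))
        \<longlongrightarrow> sgn (x $ i $ j) * x $ i $ j) (at_right 0)"
      by (intro tendsto_intros) simp
    moreover have "sgn (x $ i $ j) * x $ i $ j > 0"
      using False by (simp add: sgn_if)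
    ultimately have "\<forall>\<^sub>F s in at_right 0. 0 < sgn (x $ i $ j) * (x $ i $ j + s * h $ i $ j)"
      by (rule order_tendstoD(1))
    then show ?thesis
    proof eventually_elim
      case (elim s)
      then have "\<bar>x $ i $ j + s * h $ i $ j\<bar> = sgn (x $ i $ j) * (x $ i $ j + s * h $ i $ j)"
        using False by (cases "x $ i $ j > 0") (auto simp: sgn_if)
      moreover have "sgn (x $ i $ j) * x $ i $ j = \<bar>x $ i $ j\<bar>"
        by (simp add: sgn_if)
      ultimately show ?case
        using False by (simp add: c_def distrib_left mult_ac)
    qed
  qed
  then have "\<forall>\<^sub>F s in at_right 0. \<forall>i j. t $ i $ j * \<bar>x $ i $ j + s * h $ i $ j\<bar>
      = t $ i $ j * \<bar>x $ i $ j\<bar> + s * (h $ i $ j * c $ i $ j)"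
    by (intro eventually_all_finite)
  moreover have "\<forall>\<^sub>F s in at_right 0. (0::real) < s"
    by (rule eventually_at_right_less)
  ultimately have "\<forall>\<^sub>F s in at_right 0. 0 < s \<and>
      weighted_l1 t (x + s *\<^sub>R h) = weighted_l1 t x + s * (h \<bullet> c)"
    by eventually_elim
      (simp add: weighted_l1_def inner_matrix sum.distrib sum_distrib_left)
  then have "\<exists>s. 0 < s \<and> weighted_l1 t (x + s *\<^sub>R h) = weighted_l1 t x + s * (h \<bullet> c)"
    by (rule eventually_happens'[rotated]) simp
  with c that show thesis by blast
qed

text \<open>
  If no subgradient were orthogonal to \<open>X\<close>, a hyperplane would separate the subgradients from the
  orthogonal complement of \<open>X\<close>. Its normal \<open>h\<close> annihilates that complement, so it lies in \<open>X\<close>, and all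
  subgradients have negative inner product with it: \<open>h\<close> is a descent direction in \<open>X\<close>.
\<close>

lemma minimizer_has_orthogonal_subgradient:
  fixes t e x :: "real^'n^'m"
  assumes X: "subspace X" and t: "\<And>i j. 0 \<le> t $ i $ j" and "x \<in> X"
    and min: "\<forall>w\<in>X. weighted_l1 t (x + e) \<le> weighted_l1 t (w + e)"
  shows "\<exists>c. weighted_l1_subgradient t (x + e) c \<and> (\<forall>w\<in>X. w \<bullet> c = 0)"
proof -
  define C where "C = {c. weighted_l1_subgradient t (x + e) c}"
  have "C \<inter> orthogonal_comp X \<noteq> {}"
  proof
    assume disj: "C \<inter> orthogonal_comp X = {}"
    have perp: "subspace (orthogonal_comp X)"
      by (rule subspace_orthogonal_comp)
    have "C \<noteq> {}"
      using weighted_l1_directional_derivative[OF t, of "x + e" 0] by (auto simp: C_def)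
    then have "\<exists>h \<beta>. (\<forall>c\<in>C. h \<bullet> c < \<beta>) \<and> (\<forall>y\<in>orthogonal_comp X. h \<bullet> y > \<beta>)"
      unfolding C_def using disj[unfolded C_def] compact_convex_subgradients[of t "x + e"]
      by (intro separating_hyperplane_compact_closed closed_subspace[OF perp]
          subspace_imp_convex[OF perp])
    then obtain h \<beta> where h: "\<And>c. c \<in> C \<Longrightarrow> h \<bullet> c < \<beta>"
      "\<And>y. y \<in> orthogonal_comp X \<Longrightarrow> h \<bullet> y > \<beta>"
      by blast
    have "\<beta> < 0"
      using h(2)[OF subspace_0[OF perp]] by simp
    have "h \<bullet> y = 0" if "y \<in> orthogonal_comp X" for y
    proof (rule ccontr)
      assume "h \<bullet> y \<noteq> 0"
      then have "h \<bullet> ((\<beta> / (h \<bullet> y)) *\<^sub>R y) = \<beta>" by simp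
      moreover have "h \<bullet> ((\<beta> / (h \<bullet> y)) *\<^sub>R y) > \<beta>"
        by (intro h(2) subspace_scale[OF perp] that)
      ultimately show False by simp
    qed
    then have "h \<in> orthogonal_comp (orthogonal_comp X)"
      by (auto simp: orthogonal_comp_def orthogonal_def inner_commute)
    then have "h \<in> X"
      using orthogonal_comp_self[OF X] by simp
    obtain c \<epsilon> where c: "weighted_l1_subgradient t (x + e) c" "\<epsilon> > 0"
      "weighted_l1 t (x + e + \<epsilon> *\<^sub>R h) = weighted_l1 t (x + e) + \<epsilon> * (h \<bullet> c)"
      by (rule weighted_l1_directional_derivative[OF t])
    have "weighted_l1 t (x + e) \<le> weighted_l1 t ((x + \<epsilon> *\<^sub>R h) + e)"
      using \<open>h \<in> X\<close> \<open>x \<in> X\<close> by (intro bspec[OF min] subspace_add[OF X] subspace_scale[OF X])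
    then have "0 \<le> \<epsilon> * (h \<bullet> c)"
      using c(3) by (simp add: add_ac)
    moreover have "h \<bullet> c < 0"
      using h(1)[of c] c(1) \<open>\<beta> < 0\<close> by (simp add: C_def)
    ultimately show False
      using c(2) by (simp add: zero_le_mult_iff)
  qed
  then show ?thesis
    by (auto simp: C_def orthogonal_comp_def orthogonal_def)
qed

section \<open>Soft thresholding\<close>

definition shrink :: "real^'n^'m \<Rightarrow> real^'n^'m \<Rightarrow> real^'n^'m" where
  "shrink t x = (\<chi> i j. max (\<bar>x $ i $ j\<bar> - t $ i $ j) 0 * sgn (x $ i $ j))"

text \<open>
  Together with \<open>shrink_unique\<close> this says that \<open>shrink t\<close> is the resolvent of the
  subdifferential, in other words the proximal map of the weighted l1 norm.
\<close>

lemma shrink_subgradient: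
  assumes t: "\<And>i j. 0 \<le> t $ i $ j"
  shows "weighted_l1_subgradient t (shrink t x) (x - shrink t x)"
  unfolding weighted_l1_subgradient_def
proof (intro allI)
  fix i j
  show "\<bar>(x - shrink t x) $ i $ j\<bar> \<le> t $ i $ j \<and>
    (x - shrink t x) $ i $ j * shrink t x $ i $ j = t $ i $ j * \<bar>shrink t x $ i $ j\<bar>"
    using t[of i j] by (auto simp: shrink_def sgn_if max_def abs_if algebra_simps)
qed

lemma shrink_unique:
  assumes "weighted_l1_subgradient t x c"
  shows "shrink t (x + c) = x"
proof -
  have "shrink t (x + c) $ i $ j = x $ i $ j" for i j
  proof -
    have c: "\<bar>c $ i $ j\<bar> \<le> t $ i $ j" "c $ i $ j * x $ i $ j = t $ i $ j * \<bar>x $ i $ j\<bar>"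
      using assms by (auto simp: weighted_l1_subgradient_def)
    consider "x $ i $ j = 0" | "x $ i $ j > 0" "c $ i $ j = t $ i $ j"
      | "x $ i $ j < 0" "c $ i $ j = - t $ i $ j"
      using c(2) mult_right_cancel[of "x $ i $ j" "c $ i $ j" "- t $ i $ j"]
      by (cases "x $ i $ j" "0::real" rule: linorder_cases) auto
    then show ?thesis
      using c(1) by cases (auto simp: shrink_def max_def sgn_if)
  qed
  then show ?thesis by (simp add: vec_eq_iff)
qed

lemma shifted_shrink_monotone:
  fixes t e :: "real^'n^'m"
  assumes "\<And>i j. 0 \<le> t $ i $ j"
  defines "S \<equiv> \<lambda>x. shrink t (x + e) - e"
  shows "(S x - S y) \<bullet> ((x - S x) - (y - S y)) \<ge> 0"
  using weighted_l1_subgradient_monotone[OF shrink_subgradient shrink_subgradient,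
      of t "x + e" "y + e"] assms(1)
  by (simp add: S_def algebra_simps)

section \<open>Gradient and divergence on the graph\<close>

lemma linear_grad: "linear (grad E)"
  by (rule linearI) (simp_all add: grad_def vec_eq_iff algebra_simps)

lemma grad_in_edge_space: "grad E u \<in> edge_space E"
  by (simp add: edge_space_def grad_def)

lemma transpose_grad: "transpose (grad E u) = - grad E u"
  by (simp add: transpose_def grad_def vec_eq_iff insert_commute)

lemma divergence_simps:
  "divergence (b + c) = divergence b + divergence c"
  "divergence (b - c) = divergence b - divergence c"
  "divergence (s *\<^sub>R b) = s *\<^sub>R divergence b"
  by (simp_all add: divergence_def vec_eq_iff sum.distrib sum_subtractf sum_distrib_left
      right_diff_distrib)

lemma antisymmetric_entries:
  fixes c :: "real^'n^'n"
  assumes "transpose c = - c"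
  shows "c $ j $ i = - c $ i $ j"
proof -
  have "transpose c $ i $ j = (- c) $ i $ j"
    by (simp only: assms)
  then show ?thesis by (simp add: transpose_def)
qed

lemma divergence_antisymmetric:
  assumes "transpose c = - c"
  shows "divergence c $ i = -2 * (\<Sum>j\<in>UNIV. c $ i $ j)"
proof -
  have "c $ j $ i - c $ i $ j = -2 * c $ i $ j" for i j
    using antisymmetric_entries[OF assms, of j i] by simp
  then show ?thesis
    unfolding divergence_def by (simp only: vec_lambda_beta sum_distrib_left)
qed

text \<open>
  Summation by parts. The edge space is needed here because \<open>grad\<close> is cut off outside the edges while
  \<open>divergence\<close> sums over all pairs.
\<close>

lemma grad_inner_eq_divergence:
  assumes "c \<in> edge_space E"
  shows "grad E w \<bullet> c = - (w \<bullet> divergence c)"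
proof -
  have "grad E w $ i $ j * c $ i $ j = w $ i * c $ i $ j - w $ j * c $ i $ j" for i j
    using assms by (auto simp: edge_space_def grad_def left_diff_distrib)
  then have "grad E w \<bullet> c = (\<Sum>i\<in>UNIV. \<Sum>j\<in>UNIV. w $ i * c $ i $ j)
      - (\<Sum>i\<in>UNIV. \<Sum>j\<in>UNIV. w $ j * c $ i $ j)"
    by (simp add: inner_matrix sum_subtractf)
  also have "(\<Sum>i\<in>UNIV. \<Sum>j\<in>UNIV. w $ j * c $ i $ j) = (\<Sum>i\<in>UNIV. \<Sum>j\<in>UNIV. w $ i * c $ j $ i)"
    by (rule sum.swap)
  finally show ?thesis
    by (simp add: inner_vec_def divergence_def sum_distrib_left sum_subtractf right_diff_distrib)
qed

lemma connected_graph_induct: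
  assumes "connected_graph E" and "\<And>i j. {i, j} \<in> E \<Longrightarrow> P i \<Longrightarrow> P j" and "P r"
  shows "P i"
proof -
  have "(r, i) \<in> {(i, j). {i, j} \<in> E}\<^sup>*"
    using assms(1) by (simp add: connected_graph_def)
  then show ?thesis
    by (induction rule: rtrancl_induct) (use assms in auto)
qed

lemma convergent_gradients_imp_convergent_potentials:
  fixes v :: "nat \<Rightarrow> real^'n::finite"
  assumes conn: "connected_graph E" and root: "\<And>n. v n $ r = w $ r"
    and lim: "(\<lambda>n. grad E (v n)) \<longlonglongrightarrow> grad E w"
  shows "v \<longlonglongrightarrow> w"
proof (rule vec_tendstoI)
  fix i
  show "(\<lambda>n. v n $ i) \<longlonglongrightarrow> w $ i"
  proof (rule connected_graph_induct[OF conn, of _ r])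
    show "(\<lambda>n. v n $ r) \<longlonglongrightarrow> w $ r" by (simp add: root)
  next
    fix i j
    assume "{i, j} \<in> E" and i: "(\<lambda>n. v n $ i) \<longlonglongrightarrow> w $ i"
    have "(\<lambda>n. grad E (v n) $ i $ j) \<longlonglongrightarrow> grad E w $ i $ j"
      by (intro tendsto_vec_nth lim)
    then have "(\<lambda>n. v n $ i - v n $ j) \<longlonglongrightarrow> w $ i - w $ j"
      using \<open>{i, j} \<in> E\<close> by (simp add: grad_def)
    from tendsto_diff[OF i this] show "(\<lambda>n. v n $ j) \<longlonglongrightarrow> w $ j" by simp
  qed
qed

section \<open>Potentials orthogonal to the boundary data\<close>

definition extend_by_zero :: "'n set \<Rightarrow> ('n \<Rightarrow> real) \<Rightarrow> real^'n" where
  "extend_by_zero B g = (\<chi> i. if i \<in> B then g i else 0)"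

lemma inner_extend_by_zero:
  fixes B :: "'n::finite set"
  shows "w \<bullet> extend_by_zero B g = (\<Sum>i\<in>B. w $ i * g i)"
  by (simp add: inner_vec_def extend_by_zero_def if_distrib[of "(*) _"] sum.If_cases cong: if_cong)

lemma M0_iff:
  fixes B :: "'n::finite set"
  shows "w \<in> M0 B g \<longleftrightarrow> w \<bullet> extend_by_zero B g = 0"
  by (simp add: M0_def inner_extend_by_zero)

lemma subspace_M0: "subspace (M0 B g)" for B :: "'n::finite set"
  by (auto simp: subspace_def M0_iff inner_left_distrib)

text \<open>
  The divergence is orthogonal to the hyperplane \<open>M0 B g\<close>, so it is a multiple of the normal vector;
  testing with \<open>vg\<close>, at which the normal takes the value 1, gives the factor.
\<close>

lemma divergence_if_orthogonal_to_grad_M0: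
  fixes vg :: "real^'n::finite"
  assumes c: "c \<in> edge_space E" and vg: "vg \<bullet> extend_by_zero B g = 1"
    and orth: "\<forall>w\<in>M0 B g. grad E w \<bullet> c = 0"
  shows "divergence c = - (grad E vg \<bullet> c) *\<^sub>R extend_by_zero B g"
proof -
  let ?g = "extend_by_zero B g"
  have "w \<bullet> divergence c = w \<bullet> (- (grad E vg \<bullet> c) *\<^sub>R ?g)" for w
  proof -
    have "w - (w \<bullet> ?g) *\<^sub>R vg \<in> M0 B g"
      by (simp add: M0_iff inner_diff_left vg)
    from bspec[OF orth this] show ?thesis
      by (simp add: grad_inner_eq_divergence[OF c] inner_diff_left mult.commute)
  qed
  then show ?thesis
    by (metis vector_eq_ldot)
qed

lemma dual_feasibleI:
  fixes B :: "'n::finite set"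
  assumes "c \<in> edge_space E" "\<And>i j. \<bar>c $ i $ j\<bar> \<le> a $ i $ j / 2"
    and "divergence c = \<mu> *\<^sub>R extend_by_zero B g"
  shows "c \<in> dual_feasible E B g a"
  using assms by (auto simp: dual_feasible_def extend_by_zero_def)

section \<open>Duality\<close>

lemma primal_objective_eq:
  assumes "a \<in> edge_space E"
  shows "primal_objective a vg w = weighted_l1 a (grad E w + grad E vg) / 2"
proof -
  have "a $ i $ j * \<bar>w $ i - w $ j + vg $ i - vg $ j\<bar>
      = a $ i $ j * \<bar>(grad E w + grad E vg) $ i $ j\<bar>" for i j
    using assms by (auto simp: grad_def edge_space_def algebra_simps)
  then show ?thesis
    unfolding primal_objective_def weighted_l1_def by (simp only:)
qed

text \<open>
  The divergence condition in \<open>dual_feasible\<close> makes \<open>c\<close> orthogonal to \<open>grad E w\<close>, so \<open>w\<close> can be added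
  to \<open>vg\<close> in the dual objective; the bound \<open>a / 2\<close> on the entries does the rest.
\<close>

lemma weak_duality:
  fixes B :: "'n::finite set"
  assumes a: "a \<in> edge_space E" and w: "w \<in> M0 B g" and c: "c \<in> dual_feasible E B g a"
  shows "dual_objective E vg c \<le> primal_objective a vg w"
proof -
  obtain \<mu> where \<mu>: "divergence c = \<mu> *\<^sub>R extend_by_zero B g"
    using c by (fastforce simp: dual_feasible_def extend_by_zero_def vec_eq_iff)
  have ce: "c \<in> edge_space E" using c by (simp add: dual_feasible_def)
  have "grad E w \<bullet> c = 0"
    using w by (simp add: grad_inner_eq_divergence[OF ce] \<mu> M0_iff)
  then have "dual_objective E vg c = ((-2 *\<^sub>R c) \<bullet> (grad E w + grad E vg)) / 2"
    by (simp add: dual_objective_def inner_add_right inner_commute)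
  also have "(-2 *\<^sub>R c) \<bullet> (grad E w + grad E vg) \<le> weighted_l1 a (grad E w + grad E vg)"
  proof (rule inner_le_weighted_l1)
    fix i j
    show "\<bar>(-2 *\<^sub>R c) $ i $ j\<bar> \<le> a $ i $ j"
      using c by (simp add: dual_feasible_def abs_mult field_simps)
  qed
  finally show ?thesis
    by (simp add: primal_objective_eq[OF a])
qed

lemma strong_duality:
  fixes B :: "'n::finite set"
  assumes a: "a \<in> edge_space E" and w: "w \<in> M0 B g" and c: "c \<in> dual_feasible E B g a"
    and eq: "primal_objective a vg w = l" "dual_objective E vg c = l"
  shows "is_arg_min (primal_objective a vg) (\<lambda>w. w \<in> M0 B g) w"
    and "is_arg_max (dual_objective E vg) (\<lambda>c. c \<in> dual_feasible E B g a) c"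
    and "primal_value B g a vg = l"
    and "dual_value E B g a vg = l"
proof -
  have lower: "l \<le> primal_objective a vg w'" if "w' \<in> M0 B g" for w'
    using weak_duality[OF a that c, of vg] eq by simp
  have upper: "dual_objective E vg c' \<le> l" if "c' \<in> dual_feasible E B g a" for c'
    using weak_duality[OF a w that, of vg] eq by simp
  show "is_arg_min (primal_objective a vg) (\<lambda>w. w \<in> M0 B g) w"
    using w lower eq by (fastforce simp: is_arg_min_def)
  show "is_arg_max (dual_objective E vg) (\<lambda>c. c \<in> dual_feasible E B g a) c"
    using c upper eq by (fastforce simp: is_arg_max_def)
  show "primal_value B g a vg = l"
    unfolding primal_value_def
    by (rule cInf_eq_minimum) (use w lower eq(1) in auto)
  show "dual_value E B g a vg = l"
    unfolding dual_value_def
    by (rule cSup_eq_maximum) (use c upper eq(2) in auto)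
qed

lemma abs_eq_if_mult_eq_mult_abs:
  fixes c s x :: real
  assumes "c * x = s * \<bar>x\<bar>" "0 \<le> s" "x \<noteq> 0"
  shows "\<bar>c\<bar> = s"
proof -
  have "\<bar>c\<bar> * \<bar>x\<bar> = s * \<bar>x\<bar>"
    using arg_cong[OF assms(1), of abs] assms(2) by (simp add: abs_mult)
  then show ?thesis using assms(3) by simp
qed

text \<open>
  The subgradient condition is Ohm's law with conductivity \<open>a / \<bar>y i - y j\<bar>\<close>. The divergence of an
  antisymmetric matrix counts every flow twice and with the opposite sign, hence the factor \<open>-2\<close>.
\<close>

lemma induced_currentI:
  fixes B :: "'n::finite set"
  assumes a: "measurement_matrix E a"
    and K: "K \<in> edge_space E" "transpose K = - K"
    and ohm: "weighted_l1_subgradient a (grad E y) K"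
    and div: "divergence K = (-2 * l) *\<^sub>R extend_by_zero B g"
  shows "induced_current E B (\<lambda>i. l * g i) a y K"
proof -
  have sym: "K $ i $ j = - K $ j $ i" "a $ i $ j = a $ j $ i" "0 \<le> a $ i $ j" for i j
    using antisymmetric_entries[OF K(2), of i j] a by (auto simp: measurement_matrix_def)
  have ohm: "K $ i $ j * (y $ i - y $ j) = a $ i $ j * \<bar>y $ i - y $ j\<bar>" for i j
  proof (cases "{i, j} \<in> E")
    case True
    then show ?thesis
      using ohm by (auto simp: weighted_l1_subgradient_def grad_def split: if_splits)
  next
    case False
    then show ?thesis
      using K(1) a by (simp add: edge_space_def measurement_matrix_def)
  qed
  have abs: "\<bar>K $ i $ j\<bar> = a $ i $ j" if "y $ i \<noteq> y $ j" for i j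
    using ohm[of i j] sym(3)[of i j] that by (intro abs_eq_if_mult_eq_mult_abs) auto
  define \<sigma> where "\<sigma> i j = (if y $ i = y $ j then \<infinity> else ereal (a $ i $ j / \<bar>y $ i - y $ j\<bar>))" for i j
  have \<sigma>: "\<sigma> i j = \<sigma> j i \<and> 0 \<le> \<sigma> i j" for i j
    using sym(2,3)[of i j] by (simp add: \<sigma>_def abs_minus_commute)
  have ohm_\<sigma>: "ereal (K $ i $ j) = \<sigma> i j * ereal (y $ i - y $ j)" if "y $ i \<noteq> y $ j" for i j
  proof -
    have "K $ i $ j = a $ i $ j * (\<bar>y $ i - y $ j\<bar> / (y $ i - y $ j))"
      using ohm[of i j] that by (simp add: eq_divide_eq)
    moreover have "\<bar>y $ i - y $ j\<bar> / (y $ i - y $ j) = (y $ i - y $ j) / \<bar>y $ i - y $ j\<bar>"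
      using that by (subst frac_eq_eq) auto
    ultimately have "K $ i $ j = a $ i $ j * ((y $ i - y $ j) / \<bar>y $ i - y $ j\<bar>)"
      by (simp only:)
    then show ?thesis using that by (simp add: \<sigma>_def)
  qed
  have flux: "(\<Sum>j\<in>UNIV. K $ i $ j) = (if i \<in> B then l * g i else 0)" for i
    using divergence_antisymmetric[OF K(2), of i] unfolding div
    by (cases "i \<in> B") (simp_all add: extend_by_zero_def)
  show ?thesis
    unfolding induced_current_def
  proof (intro conjI exI[of _ \<sigma>] allI ballI impI)
    show "current E K"
      unfolding current_def using K(1) sym(1) by blast
  qed (use \<sigma> ohm_\<sigma> abs flux in \<open>simp_all add: \<sigma>_def\<close>)
qed

section \<open>Optimality of a saddle point\<close>

text \<open>
  Transposition followed by negation fixes \<open>x\<close> and respects the weights, so \<open>- transpose c\<close> is a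
  subgradient at \<open>x\<close> as well, and the antisymmetric part is the mean of the two.
\<close>

lemma subgradient_antisymmetric_part:
  assumes a: "transpose a = a" and x: "transpose x = - x" and c: "weighted_l1_subgradient a x c"
  shows "weighted_l1_subgradient a x ((1/2) *\<^sub>R (c - transpose c))"
proof -
  have "transpose a $ i $ j = a $ i $ j" for i j
    by (simp only: a)
  then have sym: "a $ j $ i = a $ i $ j" "x $ j $ i = - x $ i $ j" for i j
    by (simp_all add: transpose_def antisymmetric_entries[OF x, of j i])
  have c': "\<bar>c $ i $ j\<bar> \<le> a $ i $ j" "c $ i $ j * x $ i $ j = a $ i $ j * \<bar>x $ i $ j\<bar>" for i j
    using c by (auto simp: weighted_l1_subgradient_def)
  have "\<bar>c $ i $ j - c $ j $ i\<bar> \<le> 2 * a $ i $ j" for i j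
    using c'(1)[of i j] c'(1)[of j i] sym(1)[of i j] by linarith
  moreover have "(c $ i $ j - c $ j $ i) * x $ i $ j = 2 * (a $ i $ j * \<bar>x $ i $ j\<bar>)" for i j
    using c'(2)[of i j] c'(2)[of j i] sym[of i j] by (simp add: left_diff_distrib)
  ultimately show ?thesis
    by (simp add: weighted_l1_subgradient_def transpose_def mult.commute)
qed

text \<open>
  The inner product of \<open>J\<close> with \<open>grad E w + grad E vg\<close> is the weighted l1 norm by the subgradient
  condition, and it is the inner product with \<open>grad E vg\<close> alone by orthogonality. This
  is the equality of the primal and dual objectives.
\<close>

lemma saddle_point_optimality:
  fixes B :: "'n::finite set" and vg w :: "real^'n" and a J :: "real^'n^'n"
  assumes a: "measurement_matrix E a" and vg: "vg \<bullet> extend_by_zero B g = 1"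
    and w: "w \<in> M0 B g" and J: "weighted_l1_subgradient a (grad E w + grad E vg) J"
    and orth: "\<forall>x\<in>M0 B g. grad E x \<bullet> J = 0"
  defines "l \<equiv> (J \<bullet> grad E vg) / 2"
  shows "is_arg_min (primal_objective a vg) (\<lambda>w. w \<in> M0 B g) w"
    and "is_arg_max (dual_objective E vg) (\<lambda>c. c \<in> dual_feasible E B g a) (- (1/2) *\<^sub>R J)"
    and "l = primal_value B g a vg" and "l = dual_value E B g a vg"
    and "induced_current E B (\<lambda>i. l * g i) a (w + vg) ((1/2) *\<^sub>R (J - transpose J))"
    and "\<And>i j. (w + vg) $ i \<noteq> (w + vg) $ j \<Longrightarrow> \<bar>J $ i $ j\<bar> = a $ i $ j"
proof -
  have ae: "a \<in> edge_space E" and asym: "transpose a = a" and apos: "\<And>i j. 0 \<le> a $ i $ j"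
    using a by (auto simp: measurement_matrix_def transpose_def vec_eq_iff)
  have J_bound: "\<bar>J $ i $ j\<bar> \<le> a $ i $ j" for i j
    using J by (simp add: weighted_l1_subgradient_def)
  have Je: "J \<in> edge_space E"
  proof -
    have "J $ i $ j = 0" if "i = j \<or> {i, j} \<notin> E" for i j
      using ae J_bound[of i j] that by (auto simp: edge_space_def)
    then show ?thesis by (simp add: edge_space_def)
  qed
  have div: "divergence J = (-2 * l) *\<^sub>R extend_by_zero B g"
    using divergence_if_orthogonal_to_grad_M0[OF Je vg orth] by (simp add: l_def inner_commute)
  have y: "grad E w + grad E vg = grad E (w + vg)"
    by (simp add: linear_add[OF linear_grad])
  have feasible: "- (1/2) *\<^sub>R J \<in> dual_feasible E B g a"
  proof (rule dual_feasibleI)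
    show "- (1/2) *\<^sub>R J \<in> edge_space E"
      using Je by (auto simp: edge_space_def)
    show "\<bar>(- (1/2) *\<^sub>R J) $ i $ j\<bar> \<le> a $ i $ j / 2" for i j
      using J_bound[of i j] by simp
    show "divergence (- (1/2) *\<^sub>R J) = l *\<^sub>R extend_by_zero B g"
      by (simp only: divergence_simps div) simp
  qed
  have "primal_objective a vg w = l"
    using inner_subgradient[OF J] bspec[OF orth w]
    by (simp add: primal_objective_eq[OF ae] l_def inner_add_right inner_commute)
  moreover have "dual_objective E vg (- (1/2) *\<^sub>R J) = l"
    by (simp add: dual_objective_def l_def)
  ultimately show "is_arg_min (primal_objective a vg) (\<lambda>w. w \<in> M0 B g) w"
    "is_arg_max (dual_objective E vg) (\<lambda>c. c \<in> dual_feasible E B g a) (- (1/2) *\<^sub>R J)"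
    "l = primal_value B g a vg" "l = dual_value E B g a vg"
    using strong_duality[OF ae w feasible, of vg l] by auto
  show "induced_current E B (\<lambda>i. l * g i) a (w + vg) ((1/2) *\<^sub>R (J - transpose J))"
  proof (rule induced_currentI[OF a])
    show "(1/2) *\<^sub>R (J - transpose J) \<in> edge_space E"
      using Je by (auto simp: edge_space_def transpose_def insert_commute)
    show "transpose ((1/2) *\<^sub>R (J - transpose J)) = - ((1/2) *\<^sub>R (J - transpose J))"
      by (simp add: transpose_def vec_eq_iff field_simps)
    show "weighted_l1_subgradient a (grad E (w + vg)) ((1/2) *\<^sub>R (J - transpose J))"
      using J unfolding y by (intro subgradient_antisymmetric_part asym transpose_grad)
    have "divergence (transpose J) = - divergence J"
      by (simp add: divergence_def transpose_def vec_eq_iff flip: sum_negf)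
    then show "divergence ((1/2) *\<^sub>R (J - transpose J)) = (-2 * l) *\<^sub>R extend_by_zero B g"
      using div by (simp add: divergence_simps vec_eq_iff)
  qed
  show "\<bar>J $ i $ j\<bar> = a $ i $ j" if "(w + vg) $ i \<noteq> (w + vg) $ j" for i j
  proof (cases "{i, j} \<in> E")
    case True
    then have "J $ i $ j * grad E (w + vg) $ i $ j = a $ i $ j * \<bar>grad E (w + vg) $ i $ j\<bar>"
      and "grad E (w + vg) $ i $ j \<noteq> 0"
      using J that unfolding y weighted_l1_subgradient_def by (blast, simp add: grad_def)
    then show ?thesis
      using apos[of i j] by (intro abs_eq_if_mult_eq_mult_abs)
  next
    case False
    then show ?thesis
      using Je ae by (simp add: edge_space_def)
  qed
qed

section \<open>The iteration as Douglas--Rachford splitting\<close>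

text \<open>
  Up to a factor 2, the left-hand side is the energy \<open>grad E z \<bullet> grad E z\<close> of the flow. It is the
  denominator in the definition of \<open>\<beta>\<close>.
\<close>

lemma flow_energy_pos:
  fixes z :: "real^'n::finite"
  assumes "\<And>i. (\<Sum>j\<in>UNIV. grad E z $ i $ j) = (if i \<in> B then g i else 0)"
    and "\<exists>i\<in>B. g i \<noteq> 0"
  shows "z \<bullet> extend_by_zero B g > 0"
proof -
  have "divergence (grad E z) = (-2) *\<^sub>R extend_by_zero B g"
    using assms(1) by (simp add: vec_eq_iff divergence_antisymmetric transpose_grad
        extend_by_zero_def)
  then have "grad E z \<bullet> grad E z = 2 * (z \<bullet> extend_by_zero B g)"
    by (simp add: grad_inner_eq_divergence grad_in_edge_space)
  moreover have "grad E z \<noteq> 0"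
  proof
    assume "grad E z = 0"
    then have "(if i \<in> B then g i else 0) = 0" for i
      using assms(1)[of i] by simp
    then show False using assms(2) by metis
  qed
  then have "grad E z \<bullet> grad E z > 0" by simp
  ultimately show ?thesis by linarith
qed

context
  fixes E :: "'n::finite set set" and B :: "'n set" and g :: "'n \<Rightarrow> real"
    and a :: "real^'n^'n" and \<alpha> :: real and vg z :: "real^'n" and r :: 'n
    and u v :: "nat \<Rightarrow> real^'n" and \<beta> :: "nat \<Rightarrow> real" and b d :: "nat \<Rightarrow> real^'n^'n"
  assumes alg: "algorithm2 E B g a \<alpha> vg r z u \<beta> v b d"
    and a: "measurement_matrix E a" and g_nz: "\<exists>i\<in>B. g i \<noteq> 0"
begin

lemma iterate_grounded: "v (Suc n) $ r = 0"
  using alg by (simp add: algorithm2_def)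

lemma iterate_in_M0: "v (Suc n) \<in> M0 B g"
proof -
  have "z \<bullet> extend_by_zero B g > 0"
    using alg g_nz by (intro flow_energy_pos[of E]) (auto simp: algorithm2_def)
  moreover have v: "v (Suc n) = u (Suc n) + \<beta> (Suc n) *\<^sub>R z"
    and "\<beta> (Suc n) = - (u (Suc n) \<bullet> extend_by_zero B g) / (z \<bullet> extend_by_zero B g)"
    using alg by (auto simp: algorithm2_def inner_extend_by_zero)
  ultimately show ?thesis
    unfolding M0_iff v inner_add_left inner_scaleR_left by simp
qed

lemma multiplier_update: "b (Suc n) + d (Suc n) = b n + grad E (v (Suc n))"
proof -
  have "b (Suc n) = b n + grad E (v (Suc n)) - d (Suc n)"
    using alg unfolding algorithm2_def by blast
  then show ?thesis by simp
qed

text \<open>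
  The update formula for \<open>d\<close>, with \<open>w / \<bar>w\<bar>\<close> as the sign of \<open>w\<close>. The argument is expressed through
  \<open>b (Suc n) + d (Suc n)\<close>, which is the state variable of the Douglas--Rachford iteration.
\<close>

lemma d_eq_shrink:
  "d (Suc n) = shrink ((1 / (2 * \<alpha>)) *\<^sub>R a) (b (Suc n) + d (Suc n) + grad E vg) - grad E vg"
proof -
  have "d (Suc n) $ i $ j =
    shrink ((1 / (2 * \<alpha>)) *\<^sub>R a) (b n + grad E (v (Suc n)) + grad E vg) $ i $ j
      - grad E vg $ i $ j" for i j
  proof -
    define w where "w = grad E (v (Suc n)) $ i $ j + grad E vg $ i $ j + b n $ i $ j"
    have "d (Suc n) $ i $ j =
      (if w \<noteq> 0 then max (\<bar>w\<bar> - a $ i $ j / (2 * \<alpha>)) 0 * (w / \<bar>w\<bar>) - grad E vg $ i $ j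
       else - grad E vg $ i $ j)"
      using alg[unfolded algorithm2_def, THEN conjunct2, THEN conjunct2, THEN conjunct2,
          THEN conjunct2, THEN spec, THEN conjunct2, THEN conjunct2, THEN conjunct2, THEN conjunct2,
          THEN conjunct1, THEN spec, THEN spec]
      by (simp only: Let_def w_def)
    also have "\<dots> = max (\<bar>w\<bar> - a $ i $ j / (2 * \<alpha>)) 0 * sgn w - grad E vg $ i $ j"
      by (simp add: real_sgn_eq)
    also have "w = (b n + grad E (v (Suc n)) + grad E vg) $ i $ j"
      by (simp add: w_def)
    finally show ?thesis
      by (simp add: shrink_def)
  qed
  then show ?thesis
    unfolding multiplier_update by (simp add: vec_eq_iff)
qed

lemma iterates_in_edge_space: "b n \<in> edge_space E" "d n \<in> edge_space E"
proof -
  have "b n \<in> edge_space E \<and> d n \<in> edge_space E"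
  proof (induction n)
    case 0
    then show ?case using alg unfolding algorithm2_def by blast
  next
    case (Suc n)
    have s: "subspace (edge_space E)"
      by (auto simp: subspace_def edge_space_def)
    have "b n + grad E (v (Suc n)) \<in> edge_space E"
      using Suc by (intro subspace_add[OF s] grad_in_edge_space) auto
    then have bd: "b (Suc n) + d (Suc n) \<in> edge_space E"
      by (simp add: multiplier_update)
    have "d (Suc n) \<in> edge_space E"
      using bd grad_in_edge_space[of E vg] by (subst d_eq_shrink) (auto simp: edge_space_def shrink_def)
    moreover from subspace_diff[OF s bd this] have "b (Suc n) \<in> edge_space E" by simp
    ultimately show ?case by simp
  qed
  then show "b n \<in> edge_space E" "d n \<in> edge_space E" by auto
qed

text \<open>
  By this property \<open>grad E (v (Suc n))\<close> is the projection of \<open>d n - b n\<close>. The equation for \<open>u\<close> says that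
  \<open>d n - b n - grad E (u (Suc n))\<close> is divergence free, and adding \<open>\<beta> z\<close> to \<open>u\<close> changes the divergence
  by a multiple of \<open>g\<close>, extended by zero, which \<open>M0 B g\<close> annihilates.
\<close>

lemma residual_orthogonal:
  assumes "w \<in> M0 B g"
  shows "grad E w \<bullet> (d n - b n - grad E (v (Suc n))) = 0"
proof -
  have "(\<Sum>j\<in>UNIV. grad E z $ i $ j) = (if i \<in> B then g i else 0)" for i
    using alg unfolding algorithm2_def by blast
  then have z: "divergence (grad E z) = (-2) *\<^sub>R extend_by_zero B g"
    by (simp add: vec_eq_iff divergence_antisymmetric transpose_grad extend_by_zero_def)
  have "divergence (grad E (u (Suc n))) $ i = divergence (d n) $ i - divergence (b n) $ i" for i
  proof -
    have "(\<Sum>j\<in>UNIV. grad E (u (Suc n)) $ i $ j)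
        = 1/2 * (divergence (b n) $ i - divergence (d n) $ i)"
      using alg unfolding algorithm2_def by blast
    then show ?thesis
      unfolding divergence_antisymmetric[OF transpose_grad] by simp
  qed
  then have u: "divergence (grad E (u (Suc n))) = divergence (d n) - divergence (b n)"
    by (simp add: vec_eq_iff)
  have "v (Suc n) = u (Suc n) + \<beta> (Suc n) *\<^sub>R z"
    using alg unfolding algorithm2_def by blast
  then have "grad E (v (Suc n)) = grad E (u (Suc n)) + \<beta> (Suc n) *\<^sub>R grad E z"
    by (simp add: linear_add[OF linear_grad] linear_cmul[OF linear_grad])
  then have "divergence (d n - b n - grad E (v (Suc n))) = (2 * \<beta> (Suc n)) *\<^sub>R extend_by_zero B g"
    by (simp add: divergence_simps z u)
  moreover have "d n - b n - grad E (v (Suc n)) \<in> edge_space E"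
    using iterates_in_edge_space[of n] grad_in_edge_space[of E] by (auto simp: edge_space_def)
  ultimately show ?thesis
    using assms by (simp add: grad_inner_eq_divergence M0_iff)
qed

lemma multiplier_antisymmetric:
  assumes "transpose (b 0) = - b 0"
  shows "transpose (b n) = - b n"
proof (induction n)
  case 0
  show ?case by (rule assms)
next
  case (Suc n)
  have anti: "transpose (shrink t x) = - shrink t x"
    if "transpose t = t" "transpose x = - x" for t x :: "real^'n^'n"
  proof -
    have "transpose t $ i $ j = t $ i $ j" for i j
      by (simp only: that)
    then have "t $ j $ i = t $ i $ j" for i j
      by (simp add: transpose_def)
    then have "transpose (shrink t x) $ i $ j = (- shrink t x) $ i $ j" for i j
      by (simp add: transpose_def shrink_def antisymmetric_entries[OF that(2), of j i] sgn_minus)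
    then show ?thesis
      unfolding vec_eq_iff by blast
  qed
  have add: "transpose (x + y) = transpose x + transpose y"
    "transpose (x - y) = transpose x - transpose y" for x y :: "real^'n^'n"
    by (simp_all add: transpose_def vec_eq_iff)
  have t: "transpose ((1 / (2 * \<alpha>)) *\<^sub>R a) = (1 / (2 * \<alpha>)) *\<^sub>R a"
    using a by (simp add: transpose_def vec_eq_iff measurement_matrix_def)
  have q: "transpose (b (Suc n) + d (Suc n)) = - (b (Suc n) + d (Suc n))"
    by (simp add: multiplier_update add Suc transpose_grad)
  then have "transpose (b (Suc n) + d (Suc n) + grad E vg) = - (b (Suc n) + d (Suc n) + grad E vg)"
    by (simp add: add transpose_grad)
  from anti[OF t this] have "transpose (d (Suc n)) = - d (Suc n)"
    by (subst (1 2) d_eq_shrink) (simp add: add transpose_grad)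
  moreover have "transpose (b (Suc n)) = transpose (b (Suc n) + d (Suc n)) - transpose (d (Suc n))"
    by (simp add: add)
  ultimately show ?case
    by (simp add: q)
qed

end

text \<open>
  The state is shifted by one index, because \<open>d\<close> is a thresholded matrix only from index 1 on:
  \<open>d 0\<close> is arbitrary.
\<close>

lemma algorithm2_converges_to_saddle_point:
  fixes E :: "'n::finite set set" and v :: "nat \<Rightarrow> real^'n" and b d :: "nat \<Rightarrow> real^'n^'n"
  assumes conn: "connected_graph E" and a: "measurement_matrix E a" and \<alpha>: "\<alpha> > 0"
    and g: "\<exists>i\<in>B. g i \<noteq> 0" "(\<Sum>i\<in>B. g i) = 0"
    and alg: "algorithm2 E B g a \<alpha> vg r z u \<beta> v b d"
  shows "\<exists>w J. v \<longlonglongrightarrow> w \<and> b \<longlonglongrightarrow> (1 / (2 * \<alpha>)) *\<^sub>R J \<and> d \<longlonglongrightarrow> grad E w \<and> w \<in> M0 B g \<and>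
    weighted_l1_subgradient a (grad E w + grad E vg) J \<and> (\<forall>x\<in>M0 B g. grad E x \<bullet> J = 0)"
proof -
  note facts = alg a g(1)
  define t where "t = (1 / (2 * \<alpha>)) *\<^sub>R a"
  define e where "e = grad E vg"
  define X where "X = grad E ` M0 B g"
  define S where "S x = shrink t (x + e) - e" for x
  define q where "q n = b (Suc n) + d (Suc n)" for n
  have t: "0 \<le> t $ i $ j" for i j
    using a \<alpha> by (simp add: t_def measurement_matrix_def)
  have X: "subspace X"
    unfolding X_def by (intro linear_subspace_image linear_grad subspace_M0)
  have d_S: "d (Suc n) = S (q n)" for n
    using d_eq_shrink[OF facts, of n] by (simp add: S_def q_def t_def e_def)
  then have b_S: "b (Suc n) = q n - S (q n)" for n
    by (simp add: q_def flip: d_S)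
  obtain x0 where x0: "x0 \<in> X" "\<forall>x\<in>X. weighted_l1 t (x0 + e) \<le> weighted_l1 t (x + e)"
    using weighted_l1_minimizer_exists[OF X t, of e] by blast
  obtain c0 where c0: "weighted_l1_subgradient t (x0 + e) c0" "\<forall>x\<in>X. x \<bullet> c0 = 0"
    using minimizer_has_orthogonal_subgradient[OF X t x0] by blast
  have "S (x0 + c0) = x0"
    using shrink_unique[OF c0(1)] by (simp add: S_def add_ac)
  then have fixed: "S (x0 + c0) \<in> X" "x \<in> X \<Longrightarrow> x \<bullet> ((x0 + c0) - S (x0 + c0)) = 0" for x
    using x0(1) c0(2) by simp_all
  have mono: "(S x - S y) \<bullet> ((x - S x) - (y - S y)) \<ge> 0" for x y
    unfolding S_def by (rule shifted_shrink_monotone[OF t])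
  have step: "q (Suc n) = q n - S (q n) + grad E (v (Suc (Suc n)))" for n
  proof -
    have "q (Suc n) = b (Suc n) + grad E (v (Suc (Suc n)))"
      unfolding q_def by (rule multiplier_update[OF facts])
    then show ?thesis by (simp only: b_S)
  qed
  have grad_X: "grad E (v (Suc (Suc n))) \<in> X" for n
    unfolding X_def by (intro imageI iterate_in_M0[OF facts])
  have orth: "x \<bullet> (2 *\<^sub>R S (q n) - q n - grad E (v (Suc (Suc n)))) = 0" if "x \<in> X" for x n
  proof -
    have "2 *\<^sub>R S (q n) - q n = d (Suc n) - b (Suc n)"
      by (simp add: d_S b_S scaleR_2)
    then show ?thesis
      using that residual_orthogonal[OF facts, of _ "Suc n"] by (auto simp: X_def)
  qed
  have "\<exists>x. q \<longlonglongrightarrow> x \<and> (\<lambda>n. S (q n)) \<longlonglongrightarrow> S x \<and>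
    (\<lambda>n. grad E (v (Suc (Suc n)))) \<longlonglongrightarrow> S x \<and> S x \<in> X \<and> (\<forall>y\<in>X. y \<bullet> (x - S x) = 0)"
    by (rule douglas_rachford_converges[of X S q "\<lambda>n. grad E (v (Suc (Suc n)))" "x0 + c0"])
      (rule X mono step grad_X fixed(1) | erule orth fixed(2))+
  then obtain x where x: "q \<longlonglongrightarrow> x" "(\<lambda>n. S (q n)) \<longlonglongrightarrow> S x"
    "(\<lambda>n. grad E (v (Suc (Suc n)))) \<longlonglongrightarrow> S x" "S x \<in> X" "\<forall>y\<in>X. y \<bullet> (x - S x) = 0"
    by (elim exE conjE)
  obtain w0 where w0: "w0 \<in> M0 B g" "S x = grad E w0"
    using x(4) by (auto simp: X_def)
  \<comment> \<open>Constants have zero gradient and lie in \<open>M0 B g\<close>, so the limit potential can be grounded at \<open>r\<close>.\<close>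
  define w where "w = w0 - (\<chi> i. w0 $ r)"
  have w: "w \<in> M0 B g" "grad E w = S x" "w $ r = 0"
    using w0 g(2) by (auto simp: w_def M0_def left_diff_distrib sum_subtractf grad_def vec_eq_iff
        simp flip: sum_distrib_left)
  define J where "J = (2 * \<alpha>) *\<^sub>R (x - S x)"
  have J: "(1 / (2 * \<alpha>)) *\<^sub>R J = x - S x"
    using \<alpha> by (simp add: J_def)
  show ?thesis
  proof (intro exI[of _ w] exI[of _ J] conjI ballI)
    have "(\<lambda>n. v (Suc (Suc n))) \<longlonglongrightarrow> w"
      by (rule convergent_gradients_imp_convergent_potentials[OF conn, of _ r])
        (use x(3) w iterate_grounded[OF facts] in auto)
    from LIMSEQ_imp_Suc[OF LIMSEQ_imp_Suc[OF this]] show "v \<longlonglongrightarrow> w" .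
    have "(\<lambda>n. b (Suc n)) \<longlonglongrightarrow> x - S x"
      unfolding b_S by (intro tendsto_diff x)
    then show "b \<longlonglongrightarrow> (1 / (2 * \<alpha>)) *\<^sub>R J"
      unfolding J by (rule LIMSEQ_imp_Suc)
    show "d \<longlonglongrightarrow> grad E w"
      using x(2) unfolding w(2) d_S[symmetric] by (rule LIMSEQ_imp_Suc)
    show "w \<in> M0 B g" by (rule w)
    have "weighted_l1_subgradient t (S x + e) (x - S x)"
      using shrink_subgradient[OF t, of "x + e"] by (simp add: S_def algebra_simps)
    then have "weighted_l1_subgradient ((2 * \<alpha>) *\<^sub>R t) (S x + e) J"
      unfolding J_def using \<alpha> by (intro weighted_l1_subgradient_scaleR) simp_all
    then show "weighted_l1_subgradient a (grad E w + grad E vg) J"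
      using \<alpha> by (simp add: w(2) e_def t_def)
    show "grad E y \<bullet> J = 0" if "y \<in> M0 B g" for y
      using x(5) that by (simp add: J_def X_def)
  qed
qed

theorem proposition4p2:
  fixes E :: "'n::finite set set" and B :: "'n set" and g :: "'n \<Rightarrow> real"
    and a :: "real^'n^'n" and \<alpha> :: real and v\<^sub>g z :: "real^'n" and r :: 'n
    and u v :: "nat \<Rightarrow> real^'n" and \<beta> :: "nat \<Rightarrow> real"
    and b d :: "nat \<Rightarrow> real^'n^'n"
  assumes "simple_graph E" and "connected_graph E"
    and "\<exists>i\<in>B. g i \<noteq> 0" and "(\<Sum>i\<in>B. g i) = 0"
    and "measurement_matrix E a"
    and "\<alpha> > 0"
    and "(\<Sum>i\<in>B. v\<^sub>g $ i * g i) = 1"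
    and "algorithm2 E B g a \<alpha> v\<^sub>g r z u \<beta> v b d"
  shows "\<exists>v' J l.
      v \<longlonglongrightarrow> v' \<and>
      b \<longlonglongrightarrow> (1 / (2 * \<alpha>)) *\<^sub>R J \<and>
      d \<longlonglongrightarrow> grad E v' \<and>
      is_arg_min (primal_objective a v\<^sub>g) (\<lambda>w. w \<in> M0 B g) v' \<and>
      is_arg_max (dual_objective E v\<^sub>g) (\<lambda>c. c \<in> dual_feasible E B g a) (- (1/2) *\<^sub>R J) \<and>
      v' + v\<^sub>g \<in> voltage_potentials E B (\<lambda>i. l * g i) a \<and>
      induced_current E B (\<lambda>i. l * g i) a (v' + v\<^sub>g) ((1/2) *\<^sub>R (J - transpose J)) \<and>
      (transpose (b 0) = - b 0 \<longrightarrow> induced_current E B (\<lambda>i. l * g i) a (v' + v\<^sub>g) J) \<and>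
      (\<forall>i j. (v' + v\<^sub>g) $ i \<noteq> (v' + v\<^sub>g) $ j \<longrightarrow> \<bar>J $ i $ j\<bar> = a $ i $ j) \<and>
      l = primal_value B g a v\<^sub>g \<and>
      l = dual_value E B g a v\<^sub>g"
proof -
  obtain w J where lim: "v \<longlonglongrightarrow> w" "b \<longlonglongrightarrow> (1 / (2 * \<alpha>)) *\<^sub>R J" "d \<longlonglongrightarrow> grad E w"
    and saddle: "w \<in> M0 B g" "weighted_l1_subgradient a (grad E w + grad E v\<^sub>g) J"
      "\<forall>x\<in>M0 B g. grad E x \<bullet> J = 0"
    using algorithm2_converges_to_saddle_point[OF assms(2,5,6,3,4,8)] by blast
  have vg: "v\<^sub>g \<bullet> extend_by_zero B g = 1"
    using assms(7) by (simp add: inner_extend_by_zero)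
  note opt = saddle_point_optimality[OF assms(5) vg saddle]
  have J_eq: "(1/2) *\<^sub>R (J - transpose J) = J" if anti: "transpose (b 0) = - b 0"
  proof -
    have J_anti: "J $ j $ i = - J $ i $ j" for i j
    proof -
      have "b n $ j $ i = - b n $ i $ j" for n
        by (rule antisymmetric_entries[OF multiplier_antisymmetric[OF assms(8,5,3) anti]])
      then have "(\<lambda>n. - b n $ i $ j) \<longlonglongrightarrow> ((1 / (2 * \<alpha>)) *\<^sub>R J) $ j $ i"
        using tendsto_vec_nth[OF tendsto_vec_nth[OF lim(2), of j], of i] by (simp only:)
      moreover have "(\<lambda>n. - b n $ i $ j) \<longlonglongrightarrow> - ((1 / (2 * \<alpha>)) *\<^sub>R J) $ i $ j"
        by (intro tendsto_minus tendsto_vec_nth lim)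
      ultimately have "((1 / (2 * \<alpha>)) *\<^sub>R J) $ j $ i = - ((1 / (2 * \<alpha>)) *\<^sub>R J) $ i $ j"
        by (rule LIMSEQ_unique)
      then have "J $ j $ i / (2 * \<alpha>) = (- J $ i $ j) / (2 * \<alpha>)" by simp
      then show ?thesis
        using assms(6) by (subst (asm) divide_cancel_right) auto
    qed
    have "J $ i $ j - J $ j $ i = 2 * J $ i $ j" for i j
      using J_anti[of i j] by simp
    then show ?thesis by (simp add: vec_eq_iff transpose_def)
  qed
  have anti: "transpose (b 0) = - b 0 \<longrightarrow>
      induced_current E B (\<lambda>i. J \<bullet> grad E v\<^sub>g / 2 * g i) a (w + v\<^sub>g) J"
    using opt(5) J_eq by (intro impI) (simp only:)
  have vp: "w + v\<^sub>g \<in> voltage_potentials E B (\<lambda>i. J \<bullet> grad E v\<^sub>g / 2 * g i) a"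
    unfolding voltage_potentials_def using opt(5) by blast
  show ?thesis
  proof (rule exI[of _ w], rule exI[of _ J], rule exI[of _ "J \<bullet> grad E v\<^sub>g / 2"], intro conjI)
    show "is_arg_max (dual_objective E v\<^sub>g) (\<lambda>c. c \<in> dual_feasible E B g a) (- (1/2) *\<^sub>R J)"
      by (fact opt(2))
    show "\<forall>i j. (w + v\<^sub>g) $ i \<noteq> (w + v\<^sub>g) $ j \<longrightarrow> \<bar>J $ i $ j\<bar> = a $ i $ j"
      using opt(6) by blast
  qed (fact lim opt vp anti)+
qed

end
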